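(* Let the rows of the $n\times(p+1)$ random matrix $(X,Y)$ be i.i.d. copies of $(X_0,Y_0)$, where $X_0\in\mathbb{R}^p$ is a random row vector and $Y_0\in\mathbb{R}$. Let $\Sigma_0:=\mathbb{E}X_0^TX_0$ be invertible, $\Theta_0:=\Sigma_0^{-1}$, $\hat\Sigma:=X^TX/n$, let $\beta^0$ minimize $\mathbb{E}(Y_0-X_0\beta)^2$ over $\beta\in\mathbb{R}^p$, and let $\epsilon:=Y-X\beta^0$. For $\lambda>0$ let $\hat\beta$ be the Lasso, i.e. a minimizer over $\beta\in\mathbb{R}^p$ of $\|Y-X\beta\|_n^2+2\lambda\|\beta\|_1$. Then $$\|\hat\beta-\beta^0\|_\infty\le\|\Theta_0X^T\epsilon\|_\infty/n+|||\Theta_0|||_1\Big(\|\hat\Sigma-\Sigma_0\|_\infty\|\hat\beta-\beta^0\|_1+\lambda\Big).$$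
   Context: For $v\in\mathbb{R}^n$, $\|v\|_n:=\sqrt{v^Tv/n}$. For a matrix $A$, $\|A\|_\infty:=\max_{k,j}|A_{k,j}|$ and $|||A|||_1:=\max_j\sum_k|A_{k,j}|$; for vectors, $\|\cdot\|_1$ and $\|\cdot\|_\infty$ are the usual $\ell_1$- and $\ell_\infty$-norms. $X_0$ and $Y_0$ have finite second moments. *)

theory Defs
  imports "HOL-Probability.Probability"
begin

definition empirical_norm :: "real ^ 'n \<Rightarrow> real" where
  "empirical_norm v = sqrt (v \<bullet> v / real CARD('n))"

definition l1_norm :: "real ^ 'n \<Rightarrow> real" where
  "l1_norm v = (\<Sum>j\<in>UNIV. \<bar>v $ j\<bar>)"

definition max_entry_norm :: "real ^ 'n ^ 'm \<Rightarrow> real" where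
  "max_entry_norm A = (MAX (k, j). \<bar>A $ k $ j\<bar>)"

definition max_col_sum_norm :: "real ^ 'n ^ 'm \<Rightarrow> real" where
  "max_col_sum_norm A = (MAX j. \<Sum>k\<in>UNIV. \<bar>A $ k $ j\<bar>)"

text \<open>The uncentred matrix \<open>E X\<^sub>0\<^sup>T X\<^sub>0\<close> of a random row vector \<open>X\<^sub>0\<close>, with the expectation
  taken entrywise.\<close>

definition second_moment_matrix :: "'a measure \<Rightarrow> ('a \<Rightarrow> real ^ 'p) \<Rightarrow> real ^ 'p ^ 'p" where
  "second_moment_matrix N X\<^sub>0 = (\<chi> k j. \<integral>\<omega>. X\<^sub>0 \<omega> $ k * X\<^sub>0 \<omega> $ j \<partial>N)"

definition empirical_gram :: "real ^ 'p ^ 'n \<Rightarrow> real ^ 'p ^ 'p" where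
  "empirical_gram X = (1 / real CARD('n)) *\<^sub>R (transpose X ** X)"

text \<open>The index type \<open>'n\<close> enumerates the sample. The population pair \<open>(X\<^sub>0, Y\<^sub>0)\<close> may live on
  a probability space \<open>N\<close> different from the space \<open>M\<close> carrying the sample.\<close>

definition iid_sample ::
    "'a measure \<Rightarrow> ('a \<Rightarrow> real ^ 'p ^ 'n) \<Rightarrow> ('a \<Rightarrow> real ^ 'n) \<Rightarrow>
     'b measure \<Rightarrow> ('b \<Rightarrow> real ^ 'p) \<Rightarrow> ('b \<Rightarrow> real) \<Rightarrow> bool" where
  "iid_sample M X Y N X\<^sub>0 Y\<^sub>0 \<longleftrightarrow>
     prob_space.indep_vars M (\<lambda>_. borel) (\<lambda>i \<omega>. (row i (X \<omega>), Y \<omega> $ i)) UNIV \<and>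
     (\<forall>i. distr M borel (\<lambda>\<omega>. (row i (X \<omega>), Y \<omega> $ i)) = distr N borel (\<lambda>\<omega>. (X\<^sub>0 \<omega>, Y\<^sub>0 \<omega>)))"

definition is_lasso :: "real ^ 'p ^ 'n \<Rightarrow> real ^ 'n \<Rightarrow> real \<Rightarrow> real ^ 'p \<Rightarrow> bool" where
  "is_lasso X Y lam b \<longleftrightarrow>
     is_arg_min (\<lambda>b. (empirical_norm (Y - X *v b))\<^sup>2 + 2 * lam * l1_norm b) (\<lambda>_. True) b"

end

theory Submission
  imports Defs
begin

text \<open>First-order optimality of the Lasso bounds every entry of \<open>X\<^sup>T (Y - X \<beta>hat) / n\<close> by
  \<open>lam\<close>. Since \<open>Y = X \<beta>\<^sub>0 + \<epsilon>\<close>, multiplying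
  \<open>\<Sigma>\<^sub>0 (\<beta>hat - \<beta>\<^sub>0) = X\<^sup>T \<epsilon> / n - (\<Sigma>hat - \<Sigma>\<^sub>0) (\<beta>hat - \<beta>\<^sub>0) - X\<^sup>T (Y - X \<beta>hat) / n\<close>
  by \<open>\<Theta>\<^sub>0\<close> reduces the claim to Hoelder's inequality; as \<open>\<Theta>\<^sub>0\<close> is symmetric, its maximal row sum
  is its maximal column sum.\<close>

lemma infnorm_le_iff_cart:
  fixes v :: "real ^ 'n"
  shows "infnorm v \<le> c \<longleftrightarrow> (\<forall>i. \<bar>v $ i\<bar> \<le> c)"
proof
  assume "infnorm v \<le> c"
  then show "\<forall>i. \<bar>v $ i\<bar> \<le> c"
    using component_le_infnorm_cart order_trans by blast
next
  assume "\<forall>i. \<bar>v $ i\<bar> \<le> c"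
  then show "infnorm v \<le> c"
    unfolding infnorm_cart by (intro cSup_least) auto
qed

text \<open>Hoelder's inequality in each row: the entries are bounded uniformly and \<open>v\<close>
  is summed. It serves for the Gram error, which is small entrywise.\<close>

lemma infnorm_matrix_vector_le_max_entry_norm:
  fixes A :: "real ^ 'n ^ 'm" and v :: "real ^ 'n"
  shows "infnorm (A *v v) \<le> max_entry_norm A * l1_norm v"
  unfolding infnorm_le_iff_cart
proof
  fix i
  have entry: "\<bar>A $ i $ j\<bar> \<le> max_entry_norm A" for j
    unfolding max_entry_norm_def
    by (rule Max_ge) (auto intro: image_eqI[where x = "(i, j)"])
  have "\<bar>(A *v v) $ i\<bar> \<le> (\<Sum>j\<in>UNIV. \<bar>A $ i $ j * v $ j\<bar>)"
    by (simp add: matrix_vector_mult_def)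
  also have "\<dots> \<le> (\<Sum>j\<in>UNIV. max_entry_norm A * \<bar>v $ j\<bar>)"
    by (intro sum_mono) (simp add: abs_mult mult_right_mono entry)
  finally show "\<bar>(A *v v) $ i\<bar> \<le> max_entry_norm A * l1_norm v"
    by (simp add: l1_norm_def sum_distrib_left)
qed

text \<open>Hoelder's inequality with the roles exchanged: here each row is summed. The operator
  norm induced by \<open>infnorm\<close> is the maximal row sum, hence the
  \<open>transpose\<close>.\<close>

lemma infnorm_matrix_vector_le_max_col_sum_norm_transpose:
  fixes A :: "real ^ 'n ^ 'm" and v :: "real ^ 'n"
  shows "infnorm (A *v v) \<le> max_col_sum_norm (transpose A) * infnorm v"
  unfolding infnorm_le_iff_cart
proof
  fix i
  have "\<bar>(A *v v) $ i\<bar> \<le> (\<Sum>j\<in>UNIV. \<bar>A $ i $ j * v $ j\<bar>)"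
    by (simp add: matrix_vector_mult_def)
  also have "\<dots> \<le> (\<Sum>j\<in>UNIV. \<bar>A $ i $ j\<bar> * infnorm v)"
    by (intro sum_mono) (simp add: abs_mult mult_left_mono component_le_infnorm_cart)
  also have "\<dots> = (\<Sum>j\<in>UNIV. \<bar>transpose A $ j $ i\<bar>) * infnorm v"
    by (simp add: sum_distrib_right transpose_def)
  also have "\<dots> \<le> max_col_sum_norm (transpose A) * infnorm v"
    unfolding max_col_sum_norm_def
    by (intro mult_right_mono Max_ge) (auto simp: infnorm_pos_le)
  finally show "\<bar>(A *v v) $ i\<bar> \<le> max_col_sum_norm (transpose A) * infnorm v" .
qed

lemma max_col_sum_norm_nonneg: "0 \<le> max_col_sum_norm A"
proof -
  \<comment> \<open>\<open>undefined\<close> is just some column index; any column would do.\<close>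
  have "0 \<le> (\<Sum>k\<in>UNIV. \<bar>A $ k $ undefined\<bar>)"
    by (simp add: sum_nonneg)
  also have "\<dots> \<le> max_col_sum_norm A"
    unfolding max_col_sum_norm_def by (intro Max_ge) auto
  finally show ?thesis .
qed

lemma transpose_second_moment_matrix:
  "transpose (second_moment_matrix N X\<^sub>0) = second_moment_matrix N X\<^sub>0"
  by (simp add: transpose_def second_moment_matrix_def mult.commute)

lemma matrix_inv_mult:
  fixes A :: "'a::semiring_1 ^ 'n ^ 'm"
  assumes "invertible A"
  shows "A ** matrix_inv A = mat 1" and "matrix_inv A ** A = mat 1"
  using someI_ex[OF assms[unfolded invertible_def]] by (simp_all add: matrix_inv_def)

text \<open>Transposing \<open>A ** ?B = mat 1\<close> makes \<open>transpose ?B\<close> a left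
  inverse of \<open>A\<close>, and a left inverse coincides with the right inverse
  \<open>?B\<close>.\<close>

lemma transpose_matrix_inv_symmetric:
  fixes A :: "real ^ 'n ^ 'n"
  assumes inv: "invertible A" and sym: "transpose A = A"
  shows "transpose (matrix_inv A) = matrix_inv A"
proof -
  let ?B = "matrix_inv A"
  have "transpose ?B ** A = mat 1"
    using arg_cong[OF matrix_inv_mult(1)[OF inv], of transpose]
    by (simp add: matrix_transpose_mul sym)
  then have "(transpose ?B ** A) ** ?B = ?B"
    by simp
  then show ?thesis
    by (simp add: matrix_mul_assoc[symmetric] matrix_inv_mult(1)[OF inv])
qed

text \<open>Replaces subgradient calculus at the kink of the absolute value: after division by a
  small step, the quadratic term vanishes in the limit.\<close>

lemma abs_le_if_quadratic_perturbation:
  fixes a c l :: real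
  assumes ineq: "\<And>t. 2 * (t * a) \<le> t\<^sup>2 * c + 2 * l * \<bar>t\<bar>"
  shows "\<bar>a\<bar> \<le> l"
proof -
  have "2 * \<bar>a\<bar> \<le> s * c + 2 * l" if "0 < s" for s
  proof -
    have "s * (2 * \<bar>a\<bar>) \<le> s * (s * c + 2 * l)"
      \<comment> \<open>The step takes the sign of \<open>a\<close>, so that one of the two
        instances has \<open>s * \<bar>a\<bar>\<close> on its left.\<close>
      using ineq[of s] ineq[of "- s"] that
      by (auto simp: abs_if algebra_simps power2_eq_square)
    then show ?thesis
      using that by simp
  qed
  then have "\<forall>\<^sub>F s in at_right 0. 2 * \<bar>a\<bar> \<le> s * c + 2 * l"
    by (auto simp: eventually_at_filter)
  moreover have "((\<lambda>s. s * c + 2 * l) \<longlongrightarrow> 0 * c + 2 * l) (at_right 0)"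
    by (intro tendsto_intros)
  ultimately have "2 * \<bar>a\<bar> \<le> 0 * c + 2 * l"
    by (intro tendsto_lowerbound) auto
  then show ?thesis
    by simp
qed

lemma empirical_norm_power2: "(empirical_norm v)\<^sup>2 = v \<bullet> v / real CARD('n)"
  for v :: "real ^ 'n"
  by (simp add: empirical_norm_def)

lemma l1_norm_triangle: "l1_norm (u + v) \<le> l1_norm u + l1_norm v"
  unfolding l1_norm_def sum.distrib[symmetric] by (intro sum_mono) simp

lemma l1_norm_axis: "l1_norm (axis j t) = \<bar>t\<bar>"
  by (simp add: l1_norm_def axis_def if_distrib[of abs] cong: if_cong)

text \<open>Moving \<open>b\<close> by \<open>t\<close> along one axis costs at most
  \<open>2 * lam * \<bar>t\<bar>\<close> in the penalty and changes the loss by a quadratic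
  polynomial in \<open>t\<close>. Minimality of \<open>b\<close> then gives the premise of
  \<open>abs_le_if_quadratic_perturbation\<close>.\<close>

lemma lasso_residual_correlation_le:
  fixes X :: "real ^ 'p ^ 'n"
  assumes "is_lasso X Y lam b" and "0 \<le> lam"
  shows "infnorm (transpose X *v (Y - X *v b)) / real CARD('n) \<le> lam"
proof -
  let ?n = "real CARD('n)" and ?r = "Y - X *v b"
  have n: "0 < ?n"
    by simp
  have "\<bar>(transpose X *v ?r) $ j / ?n\<bar> \<le> lam" for j
  proof (rule abs_le_if_quadratic_perturbation)
    fix t :: real
    let ?x = "column j X"
    have inner: "?x \<bullet> ?r = (transpose X *v ?r) $ j"
      by (simp add: matrix_vector_mult_def transpose_def column_def inner_vec_def)
    have res: "Y - X *v (b + axis j t) = ?r - t *\<^sub>R ?x"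
      by (simp add: vec_eq_iff matrix_vector_mult_def column_def axis_def
          algebra_simps sum.distrib if_distrib[of "(*) _"] cong: if_cong)
    have "(empirical_norm ?r)\<^sup>2 + 2 * lam * l1_norm b
        \<le> (empirical_norm (Y - X *v (b + axis j t)))\<^sup>2 + 2 * lam * l1_norm (b + axis j t)"
      using assms(1) by (auto simp: is_lasso_def is_arg_min_def not_less)
    also have "\<dots> \<le> (empirical_norm (?r - t *\<^sub>R ?x))\<^sup>2 + 2 * lam * (l1_norm b + \<bar>t\<bar>)"
      using l1_norm_triangle[of b "axis j t"] \<open>0 \<le> lam\<close>
      unfolding res l1_norm_axis by (intro add_left_mono mult_left_mono) auto
    finally have "?r \<bullet> ?r / ?n \<le> (?r - t *\<^sub>R ?x) \<bullet> (?r - t *\<^sub>R ?x) / ?n + 2 * lam * \<bar>t\<bar>"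
      by (simp add: empirical_norm_power2 algebra_simps)
    \<comment> \<open>The term \<open>?r \<bullet> ?r\<close> cancels between the two objectives;
      \<open>(?x \<bullet> ?x) / ?n\<close> becomes the coefficient \<open>c\<close> of the
      quadratic term.\<close>
    moreover have "(?r - t *\<^sub>R ?x) \<bullet> (?r - t *\<^sub>R ?x)
        = ?r \<bullet> ?r - 2 * (t * (?x \<bullet> ?r)) + t\<^sup>2 * (?x \<bullet> ?x)"
      by (simp add: inner_diff_left inner_diff_right inner_commute power2_eq_square)
    ultimately show "2 * (t * ((transpose X *v ?r) $ j / ?n))
        \<le> t\<^sup>2 * ((?x \<bullet> ?x) / ?n) + 2 * lam * \<bar>t\<bar>"
      by (simp add: inner add_divide_distrib diff_divide_distrib)
  qed
  then have "\<bar>(transpose X *v ?r) $ j\<bar> \<le> lam * ?n" for j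
    using n by (simp add: abs_divide pos_divide_le_eq)
  then have "infnorm (transpose X *v ?r) \<le> lam * ?n"
    by (simp add: infnorm_le_iff_cart)
  then show ?thesis
    using n by (simp add: pos_divide_le_eq)
qed

text \<open>The deterministic core, for one realisation of the sample, with \<open>S\<close> in the
  place of \<open>\<Sigma>\<^sub>0\<close>.\<close>

lemma lasso_infnorm_error_le:
  fixes X :: "real ^ 'p ^ 'n" and Y :: "real ^ 'n" and S :: "real ^ 'p ^ 'p" and b\<^sub>0 :: "real ^ 'p"
  assumes lasso: "is_lasso X Y lam b" and lam: "0 \<le> lam"
    and inv: "invertible S" and sym: "transpose S = S"
  shows "infnorm (b - b\<^sub>0) \<le>
    infnorm (matrix_inv S *v (transpose X *v (Y - X *v b\<^sub>0))) / real CARD('n)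
    + max_col_sum_norm (matrix_inv S) *
        (max_entry_norm (empirical_gram X - S) * l1_norm (b - b\<^sub>0) + lam)"
proof -
  let ?n = "real CARD('n)" and ?T = "matrix_inv S" and ?d = "b - b\<^sub>0"
  let ?e = "transpose X *v (Y - X *v b\<^sub>0)" and ?z = "transpose X *v (Y - X *v b)"
  \<comment> \<open>Gram error and residual correlation are kept together, so that the norm of
    \<open>?T\<close> enters once, as a common factor.\<close>
  let ?w = "(empirical_gram X - S) *v ?d + (1 / ?n) *\<^sub>R ?z"
  \<comment> \<open>The two residuals differ by \<open>X *v ?d\<close>, as \<open>Y\<close>
    cancels.\<close>
  have gram: "empirical_gram X *v ?d = (1 / ?n) *\<^sub>R ?e - (1 / ?n) *\<^sub>R ?z"
    by (simp add: empirical_gram_def scaleR_matrix_vector_assoc[symmetric]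
        matrix_vector_mul_assoc[symmetric] matrix_vector_mult_diff_distrib algebra_simps)
  have "S *v ?d = (1 / ?n) *\<^sub>R ?e - ?w"
    using gram by (simp add: matrix_vector_mult_diff_rdistrib)
  then have "?T *v (S *v ?d) = (1 / ?n) *\<^sub>R (?T *v ?e) - ?T *v ?w"
    by (simp only: matrix_vector_mult_diff_distrib matrix_vector_mult_scaleR)
  then have "?d = (1 / ?n) *\<^sub>R (?T *v ?e) - ?T *v ?w"
    by (simp only: matrix_vector_mul_assoc matrix_inv_mult(2)[OF inv] matrix_vector_mul_lid)
  then have "infnorm ?d \<le> infnorm ((1 / ?n) *\<^sub>R (?T *v ?e)) + infnorm (?T *v ?w)"
    using infnorm_triangle[of "(1 / ?n) *\<^sub>R (?T *v ?e)" "- (?T *v ?w)"]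
    by (simp add: infnorm_neg)
  moreover have "infnorm ((1 / ?n) *\<^sub>R (?T *v ?e)) = infnorm (?T *v ?e) / ?n"
    by (simp add: infnorm_mul)
  moreover have "infnorm (?T *v ?w) \<le> max_col_sum_norm ?T * infnorm ?w"
    using infnorm_matrix_vector_le_max_col_sum_norm_transpose[of ?T ?w]
    by (simp add: transpose_matrix_inv_symmetric[OF inv sym])
  moreover have "infnorm ?w \<le> max_entry_norm (empirical_gram X - S) * l1_norm ?d + lam"
  proof -
    have "infnorm ((1 / ?n) *\<^sub>R ?z) \<le> lam"
      using lasso_residual_correlation_le[OF lasso lam] by (simp add: infnorm_mul)
    then show ?thesis
      using infnorm_triangle[of "(empirical_gram X - S) *v ?d" "(1 / ?n) *\<^sub>R ?z"]
        infnorm_matrix_vector_le_max_entry_norm[of "empirical_gram X - S" ?d]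
      by linarith
  qed
  then have "max_col_sum_norm ?T * infnorm ?w
      \<le> max_col_sum_norm ?T * (max_entry_norm (empirical_gram X - S) * l1_norm ?d + lam)"
    by (rule mult_left_mono[OF _ max_col_sum_norm_nonneg])
  ultimately show ?thesis
    by linarith
qed

theorem lemma2p5p1:
  fixes M :: "'a measure" and N :: "'b measure"
    and X :: "'a \<Rightarrow> real ^ 'p ^ 'n" and Y :: "'a \<Rightarrow> real ^ 'n"
    and X\<^sub>0 :: "'b \<Rightarrow> real ^ 'p" and Y\<^sub>0 :: "'b \<Rightarrow> real"
    and \<Sigma>\<^sub>0 \<Theta>\<^sub>0 :: "real ^ 'p ^ 'p" and \<beta>\<^sub>0 :: "real ^ 'p"
    and \<epsilon> :: "'a \<Rightarrow> real ^ 'n" and lam :: real and \<beta>hat :: "'a \<Rightarrow> real ^ 'p"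
  assumes "prob_space M" and "prob_space N"
    and "X\<^sub>0 \<in> borel_measurable N" and "Y\<^sub>0 \<in> borel_measurable N"
    and "\<And>j. integrable N (\<lambda>\<omega>. (X\<^sub>0 \<omega> $ j)\<^sup>2)"
    and "integrable N (\<lambda>\<omega>. (Y\<^sub>0 \<omega>)\<^sup>2)"
    and "iid_sample M X Y N X\<^sub>0 Y\<^sub>0"
    and "\<Sigma>\<^sub>0 = second_moment_matrix N X\<^sub>0"
    and "invertible \<Sigma>\<^sub>0"
    and "\<Theta>\<^sub>0 = matrix_inv \<Sigma>\<^sub>0"
    and "is_arg_min (\<lambda>b. \<integral>\<omega>. (Y\<^sub>0 \<omega> - X\<^sub>0 \<omega> \<bullet> b)\<^sup>2 \<partial>N) (\<lambda>_. True) \<beta>\<^sub>0"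
    and "\<epsilon> = (\<lambda>\<omega>. Y \<omega> - X \<omega> *v \<beta>\<^sub>0)"
    and "lam > 0"
    and "\<And>\<omega>. \<omega> \<in> space M \<Longrightarrow> is_lasso (X \<omega>) (Y \<omega>) lam (\<beta>hat \<omega>)"
  shows "\<forall>\<omega>\<in>space M.
    infnorm (\<beta>hat \<omega> - \<beta>\<^sub>0) \<le>
      infnorm (\<Theta>\<^sub>0 *v (transpose (X \<omega>) *v \<epsilon> \<omega>)) / real CARD('n)
      + max_col_sum_norm \<Theta>\<^sub>0 *
          (max_entry_norm (empirical_gram (X \<omega>) - \<Sigma>\<^sub>0) * l1_norm (\<beta>hat \<omega> - \<beta>\<^sub>0) + lam)"
  \<comment> \<open>The deterministic bound is applied at each outcome; a second moment matrix is
    symmetric because its entries are expectations of commuting products.\<close>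
  using assms lasso_infnorm_error_le[of "X _" "Y _" lam "\<beta>hat _" \<Sigma>\<^sub>0]
  by (simp add: transpose_second_moment_matrix)

end
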